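(* There exist absolute constants $\rho\in(0,1)$ and $c>0$, and functions $r_1,r_2:(0,\tfrac14)\to\mathbb{R}$ with $r_1(\epsilon)=O(\epsilon^2)$ and $r_2(\epsilon)=O(\epsilon^3)$, such that for any given $T$ and any policy $\pi$ there exists a problem instance $\mathfrak{J}$ of the stochastic bandit problem with random walk feedback, whose transition matrix $M$ among transient nodes is primitive and satisfies $\|M\|_\infty\le\rho<1$, with the following properties. (1) The probability of visiting any transient node from a different transient node is larger than the absolute constant $c$. (2) For any $\epsilon\in(0,\tfrac14)$, the (expected) $T$-epoch regret of $\pi$ on instance $\mathfrak{J}$ is lower bounded by $$\Big(\tfrac{32}{15}\epsilon+r_1(\epsilon)\Big)\,T\,\exp\Big(-\tfrac{112}{9}\,T\,\big(\epsilon^2+r_2(\epsilon)\big)\Big).$$ In particular, setting $\epsilon=\tfrac14T^{-1/2}$ gives that there exists a problem instance such that the (expected) regret of any algorithm on this instance is lower bounded by $\Omega(\sqrt T)$.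
   Context: Stochastic bandit problem with random walk feedback. An instance has transient nodes $[K]=\{1,\dots,K\}$ and one absorbing node $*$, transition probabilities $m_{ij}$ ($i\in[K]$, $j\in[K]\cup\{*\}$, $\sum_j m_{ij}=1$) and edge lengths $l_{ij}\in[0,1]$, which do not change across epochs. $M=[m_{ij}]_{i,j\in[K]}$ is the transition matrix among transient nodes. $M$ is primitive if some power $M^k$, $k\ge1$, has all entries positive; $\|M\|_\infty=\max_i\sum_{j\in[K]}|m_{ij}|$. In each epoch $t=1,\dots,T$ the agent picks a node $J_t\in[K]$ and observes an independent random walk trajectory $\mathcal{P}_{t,J_t}=(X_{t,0},L_{t,1},X_{t,1},\dots,L_{t,H},X_{t,H})$, where $X_{t,0}=J_t$, the nodes $X_{t,k}$ form a Markov chain with transition probabilities $m_{ij}$, $X_{t,H}=*$ with $H$ the first hitting time of $*$, and $L_{t,k}$ is the length of the edge from $X_{t,k-1}$ to $X_{t,k}$. The reward is $\mathcal{L}(\mathcal{P}_{t,J_t})=\sum_{k=1}^H L_{t,k}$. A policy (algorithm) $\pi$ chooses $J_t$ (possibly with randomization) based on the trajectories observed in epochs $1,\dots,t-1$. With $\mu_j=\mathbb{E}[\mathcal{L}(\mathcal{P}_{t,j})]$, the regret is $\mathrm{Reg}(T)=\max_{i\in[K]}\sum_{t=1}^T\mu_i-\sum_{t=1}^T\mu_{J_t}$; the lower bounds are for its expectation when the policy is run on the instance.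
   Formalization: In the last sentence the instance may depend on the algorithm (and T): for each algorithm there is an instance with regret at least a constant times √T. One instance for all algorithms is impossible, since always playing a best node there has zero regret. *)

theory Defs
  imports
    "HOL-Probability.Probability"
    "HOL-Library.Landau_Symbols"
    "Jordan_Normal_Form.Matrix"
begin

section \<open>Problem instances\<close>

text \<open>
  The \<open>K\<close> transient nodes are \<open>Some 0, \<dots>, Some (K - 1)\<close>, and \<open>None\<close> is the absorbing node.
  Values of \<open>prob\<close> and \<open>len\<close> outside the node range are irrelevant.
\<close>

type_synonym node = "nat option"

record rw_bandit =
  num_nodes :: nat
  prob :: "nat \<Rightarrow> node \<Rightarrow> real"
  len :: "nat \<Rightarrow> node \<Rightarrow> real"

definition nodes :: "rw_bandit \<Rightarrow> node set" where
  "nodes I = insert None (Some ` {..<num_nodes I})"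

definition valid_bandit :: "rw_bandit \<Rightarrow> bool" where
  "valid_bandit I \<longleftrightarrow>
     num_nodes I \<ge> 1 \<and>
     (\<forall>i<num_nodes I. (\<forall>v\<in>nodes I. 0 \<le> prob I i v) \<and> (\<Sum>v\<in>nodes I. prob I i v) = 1) \<and>
     (\<forall>i<num_nodes I. \<forall>v\<in>nodes I. 0 \<le> len I i v \<and> len I i v \<le> 1)"

definition transient_mat :: "rw_bandit \<Rightarrow> real mat" where
  "transient_mat I = Matrix.mat (num_nodes I) (num_nodes I) (\<lambda>(i, j). prob I i (Some j))"

definition primitive_mat :: "real mat \<Rightarrow> bool" where
  "primitive_mat A \<longleftrightarrow> (\<exists>k\<ge>1. \<forall>i<dim_row A. \<forall>j<dim_col A. (A ^\<^sub>m k) $$ (i, j) > 0)"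

definition inf_norm_mat :: "real mat \<Rightarrow> real" where
  "inf_norm_mat A = Max ((\<lambda>i. \<Sum>j<dim_col A. \<bar>A $$ (i, j)\<bar>) ` {..<dim_row A})"


section \<open>Trajectories\<close>

text \<open>
  A trajectory \<open>(X\<^sub>0, L\<^sub>1, X\<^sub>1, \<dots>, L\<^sub>H, X\<^sub>H)\<close> is stored as the index of the transient node
  \<open>X\<^sub>0\<close> together with the list \<open>[(L\<^sub>1, X\<^sub>1), \<dots>, (L\<^sub>H, X\<^sub>H)]\<close>.
\<close>

type_synonym trajectory = "nat \<times> (real \<times> node) list"

definition reward :: "trajectory \<Rightarrow> real" where
  "reward \<tau> = sum_list (map fst (snd \<tau>))"

definition visited :: "trajectory \<Rightarrow> node set" where
  "visited \<tau> = insert (Some (fst \<tau>)) (snd ` set (snd \<tau>))"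

text \<open>
  Probability that the chain started in the given node and stopped on reaching \<open>None\<close>
  produces exactly the given list of steps.
\<close>

fun walk_prob :: "rw_bandit \<Rightarrow> node \<Rightarrow> (real \<times> node) list \<Rightarrow> real" where
  "walk_prob I None w = (if w = [] then 1 else 0)"
| "walk_prob I (Some i) [] = 0"
| "walk_prob I (Some i) ((x, v) # w) =
     (if v \<in> nodes I \<and> x = len I i v then prob I i v * walk_prob I v w else 0)"

text \<open>
  These weights sum to 1 only if the walk is absorbed almost surely. Lemma
  \<open>pmf_walk\<close> below shows that this holds, and that \<^const>\<open>embed_pmf\<close> therefore has the
  intended value, whenever the transient matrix has norm less than 1.
\<close>

definition walk :: "rw_bandit \<Rightarrow> node \<Rightarrow> (real \<times> node) list pmf" where
  "walk I v = embed_pmf (walk_prob I v)"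

definition trajectory_pmf :: "rw_bandit \<Rightarrow> nat \<Rightarrow> trajectory pmf" where
  "trajectory_pmf I j = map_pmf (Pair j) (walk I (Some j))"

definition mean_reward :: "rw_bandit \<Rightarrow> nat \<Rightarrow> real" where
  "mean_reward I j = measure_pmf.expectation (trajectory_pmf I j) reward"

definition visit_prob :: "rw_bandit \<Rightarrow> nat \<Rightarrow> nat \<Rightarrow> real" where
  "visit_prob I i j = measure_pmf.prob (trajectory_pmf I i) {\<tau>. Some j \<in> visited \<tau>}"


section \<open>Policies and regret\<close>

text \<open>
  A policy receives the number of nodes and the trajectories of all previous epochs, oldest
  first (their first components are the nodes played so far), and returns the distribution of
  the next node.
\<close>

type_synonym policy = "nat \<Rightarrow> trajectory list \<Rightarrow> nat pmf"

definition valid_policy :: "policy \<Rightarrow> bool" where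
  "valid_policy \<pi> \<longleftrightarrow> (\<forall>K\<ge>1. \<forall>h. set_pmf (\<pi> K h) \<subseteq> {..<K})"

fun history_pmf :: "rw_bandit \<Rightarrow> policy \<Rightarrow> nat \<Rightarrow> trajectory list pmf" where
  "history_pmf I \<pi> 0 = return_pmf []"
| "history_pmf I \<pi> (Suc t) =
     bind_pmf (history_pmf I \<pi> t) (\<lambda>h.
     bind_pmf (\<pi> (num_nodes I) h) (\<lambda>j.
     map_pmf (\<lambda>\<tau>. h @ [\<tau>]) (trajectory_pmf I j)))"

definition regret :: "rw_bandit \<Rightarrow> trajectory list \<Rightarrow> real" where
  "regret I h =
     (MAX i\<in>{..<num_nodes I}. \<Sum>t<length h. mean_reward I i)
     - (\<Sum>t<length h. mean_reward I (fst (h ! t)))"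

definition expected_regret :: "rw_bandit \<Rightarrow> policy \<Rightarrow> nat \<Rightarrow> real" where
  "expected_regret I \<pi> T = measure_pmf.expectation (history_pmf I \<pi> T) (regret I)"


section \<open>Well-definedness of the trajectory law\<close>

lemma finite_nodes [simp]: "finite (nodes I)"
  by (simp add: nodes_def)

lemma sum_nodes: "(\<Sum>v\<in>nodes I. f v) = f None + (\<Sum>j<num_nodes I. f (Some j))"
  by (simp add: nodes_def sum.insert image_iff sum.reindex)

lemma walk_prob_nonneg:
  assumes "valid_bandit I" "v \<in> nodes I"
  shows "0 \<le> walk_prob I v w"
  using assms(2)
proof (induction w arbitrary: v)
  case Nil
  then show ?case by (cases v) auto
next
  case (Cons a w)
  then show ?case
    using assms(1) by (cases v; cases a) (auto simp: valid_bandit_def nodes_def)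
qed

lemma nn_integral_count_space_list:
  fixes f :: "'a list \<Rightarrow> ennreal"
  shows "(\<integral>\<^sup>+w. f w \<partial>count_space UNIV) =
         f [] + (\<integral>\<^sup>+a. \<integral>\<^sup>+w. f (a # w) \<partial>count_space UNIV \<partial>count_space UNIV)"
proof -
  let ?C = "range (\<lambda>(a, w). a # w) :: 'a list set"
  have U: "UNIV = {[]} \<union> ?C"
    by (auto simp: image_iff) (metis neq_Nil_conv)
  have "(\<integral>\<^sup>+w. f w \<partial>count_space UNIV) = (\<integral>\<^sup>+w\<in>{[]} \<union> ?C. f w \<partial>count_space UNIV)"
    using U by simp
  also have "\<dots> = (\<integral>\<^sup>+w\<in>{[]}. f w \<partial>count_space UNIV) + (\<integral>\<^sup>+w\<in>?C. f w \<partial>count_space UNIV)"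
    by (rule nn_integral_disjoint_pair_countspace) auto
  also have "(\<integral>\<^sup>+w\<in>{[]}. f w \<partial>count_space UNIV) = f []"
    by (subst nn_integral_count_space_indicator [symmetric])
       (simp_all add: nn_integral_count_space_finite)
  also have "(\<integral>\<^sup>+w\<in>?C. f w \<partial>count_space UNIV) = (\<integral>\<^sup>+w. f w \<partial>count_space ?C)"
    by (simp add: nn_integral_count_space_indicator)
  also have "\<dots> = (\<integral>\<^sup>+p. f ((\<lambda>(a, w). a # w) p) \<partial>count_space UNIV)"
    by (rule nn_integral_bij_count_space [symmetric]) (auto simp: bij_betw_def inj_on_def)
  also have "\<dots> = (\<integral>\<^sup>+a. \<integral>\<^sup>+w. f (a # w) \<partial>count_space UNIV \<partial>count_space UNIV)"
    by (subst nn_integral_fst_count_space [symmetric]) simp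
  finally show ?thesis .
qed

lemma nn_integral_walk_step:
  fixes g :: "(real \<times> node) list \<Rightarrow> ennreal"
  assumes I: "valid_bandit I" and i: "i < num_nodes I"
  shows "(\<integral>\<^sup>+w. ennreal (walk_prob I (Some i) w) * g w \<partial>count_space UNIV) =
         (\<Sum>v\<in>nodes I. ennreal (prob I i v) *
           (\<integral>\<^sup>+w. ennreal (walk_prob I v w) * g ((len I i v, v) # w) \<partial>count_space UNIV))"
proof -
  let ?A = "(\<lambda>v. (len I i v, v)) ` nodes I"
  let ?h = "\<lambda>a. \<integral>\<^sup>+w. ennreal (walk_prob I (Some i) (a # w)) * g (a # w) \<partial>count_space UNIV"
  have "(\<integral>\<^sup>+w. ennreal (walk_prob I (Some i) w) * g w \<partial>count_space UNIV) =
        (\<integral>\<^sup>+a. ?h a \<partial>count_space UNIV)"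
    by (subst nn_integral_count_space_list) simp
  also have "\<dots> = (\<Sum>a\<in>?A. ?h a)"
  proof (rule nn_integral_count_space')
    fix a assume "a \<in> UNIV" "a \<notin> ?A"
    then have "walk_prob I (Some i) (a # w) = 0" for w
      by (cases a rule: prod.exhaust) auto
    then show "?h a = 0" by simp
  qed auto
  also have "\<dots> = (\<Sum>v\<in>nodes I. ?h (len I i v, v))"
    by (subst sum.reindex) (auto simp: inj_on_def)
  also have "\<dots> = (\<Sum>v\<in>nodes I. ennreal (prob I i v) *
           (\<integral>\<^sup>+w. ennreal (walk_prob I v w) * g ((len I i v, v) # w) \<partial>count_space UNIV))"
  proof (rule sum.cong [OF refl])
    fix v assume v: "v \<in> nodes I"
    have p: "0 \<le> prob I i v"
      using I i v by (auto simp: valid_bandit_def)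
    have "?h (len I i v, v) = (\<integral>\<^sup>+w. ennreal (prob I i v) *
        (ennreal (walk_prob I v w) * g ((len I i v, v) # w)) \<partial>count_space UNIV)"
      using v p walk_prob_nonneg [OF I v] by (simp add: ennreal_mult mult.assoc)
    then show "?h (len I i v, v) = ennreal (prob I i v) *
           (\<integral>\<^sup>+w. ennreal (walk_prob I v w) * g ((len I i v, v) # w) \<partial>count_space UNIV)"
      by (simp add: nn_integral_cmult)
  qed
  finally show ?thesis .
qed

lemma transient_row_sum_le:
  assumes "valid_bandit I" "i < num_nodes I"
  shows "(\<Sum>j<num_nodes I. prob I i (Some j)) \<le> inf_norm_mat (transient_mat I)"
proof -
  let ?r = "\<lambda>i. \<Sum>j<num_nodes I. \<bar>transient_mat I $$ (i, j)\<bar>"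
  have "(\<Sum>j<num_nodes I. prob I i (Some j)) = ?r i"
    using assms by (intro sum.cong) (auto simp: transient_mat_def valid_bandit_def nodes_def)
  also have "\<dots> \<le> Max (?r ` {..<num_nodes I})"
    using assms(2) by (intro Max_ge) auto
  finally show ?thesis
    by (simp add: inf_norm_mat_def transient_mat_def)
qed

text \<open>The mass of the walks with at most \<open>n\<close> steps is at least \<open>1 - r ^ n\<close>.\<close>

lemma walk_prob_truncated:
  fixes I
  defines "r \<equiv> inf_norm_mat (transient_mat I)"
  assumes I: "valid_bandit I" and v: "v \<in> nodes I"
  shows "\<exists>s\<le>1. 1 - r ^ n \<le> s \<and> 0 \<le> s \<and> (v = None \<longrightarrow> s = 1) \<and>
    (\<integral>\<^sup>+w. ennreal (walk_prob I v w) * indicator {w. length w \<le> n} w \<partial>count_space UNIV)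
      = ennreal s"
  using v
proof (induction n arbitrary: v)
  have r0: "0 \<le> r"
  proof -
    have 0: "0 < num_nodes I" using I by (auto simp: valid_bandit_def)
    have "0 \<le> (\<Sum>j<num_nodes I. prob I 0 (Some j))"
      using I 0 by (intro sum_nonneg) (auto simp: valid_bandit_def nodes_def)
    then show ?thesis using transient_row_sum_le [OF I 0] unfolding r_def by linarith
  qed
  have absorbed: "(\<integral>\<^sup>+w. ennreal (walk_prob I None w) * indicator {w. length w \<le> n} w
      \<partial>count_space UNIV) = ennreal 1" for n
    by (subst nn_integral_count_space' [of "{[]}"]) auto
  {
    case 0
    show ?case
    proof (cases v)
      case None
      then show ?thesis using None absorbed [of 0] by (intro exI [of _ 1]) auto
    next
      case (Some i)
      have "(\<integral>\<^sup>+w. ennreal (walk_prob I (Some i) w) * indicator {w. length w \<le> 0} w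
          \<partial>count_space UNIV) = 0"
        by (subst nn_integral_count_space' [of "{[]}"]) auto
      then show ?thesis using Some by (intro exI [of _ 0]) auto
    qed
  next
    case (Suc n)
    show ?case
    proof (cases v)
      case None
      then show ?thesis using None absorbed [of "Suc n"] r0 by (intro exI [of _ 1]) auto
    next
      case (Some i)
      then have i: "i < num_nodes I" using Suc.prems by (auto simp: nodes_def)
      define P where "P u x \<longleftrightarrow> x \<le> 1 \<and> 1 - r ^ n \<le> x \<and> 0 \<le> x \<and> (u = None \<longrightarrow> x = 1) \<and>
          (\<integral>\<^sup>+w. ennreal (walk_prob I u w) * indicator {w. length w \<le> n} w \<partial>count_space UNIV)
            = ennreal x" for u x
      have "\<forall>u\<in>nodes I. \<exists>x. P u x"
        using Suc.IH unfolding P_def by blast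
      then obtain s where "\<And>u. u \<in> nodes I \<Longrightarrow> P u (s u)"
        by metis
      note s = this [unfolded P_def]
      have s1: "\<And>u. u \<in> nodes I \<Longrightarrow> s u \<le> 1" and s0: "\<And>u. u \<in> nodes I \<Longrightarrow> 0 \<le> s u"
        using s by blast+
      have p: "\<And>u. u \<in> nodes I \<Longrightarrow> 0 \<le> prob I i u" and p1: "(\<Sum>u\<in>nodes I. prob I i u) = 1"
        using I i by (auto simp: valid_bandit_def)
      define S where "S = (\<Sum>u\<in>nodes I. prob I i u * s u)"
      have "(\<integral>\<^sup>+w. ennreal (walk_prob I v w) * indicator {w. length w \<le> Suc n} w
              \<partial>count_space UNIV) =
            (\<Sum>u\<in>nodes I. ennreal (prob I i u) * (\<integral>\<^sup>+w. ennreal (walk_prob I u w) *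
              indicator {w. length w \<le> Suc n} ((len I i u, u) # w) \<partial>count_space UNIV))"
        unfolding Some by (rule nn_integral_walk_step [OF I i])
      also have "\<dots> = (\<Sum>u\<in>nodes I. ennreal (prob I i u) * (\<integral>\<^sup>+w. ennreal (walk_prob I u w) *
              indicator {w. length w \<le> n} w \<partial>count_space UNIV))"
        by (simp add: indicator_def)
      also have "\<dots> = (\<Sum>u\<in>nodes I. ennreal (prob I i u * s u))"
        using s p s0 by (intro sum.cong refl) (simp add: ennreal_mult)
      also have "\<dots> = ennreal S"
        unfolding S_def using s0 p by (intro sum_ennreal) auto
      finally have eq: "(\<integral>\<^sup>+w. ennreal (walk_prob I v w) * indicator {w. length w \<le> Suc n} w
              \<partial>count_space UNIV) = ennreal S" .
      have S0: "0 \<le> S" unfolding S_def using s0 p by (intro sum_nonneg) auto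
      have "S \<le> (\<Sum>u\<in>nodes I. prob I i u * 1)"
        unfolding S_def using s1 p by (intro sum_mono mult_left_mono) auto
      then have S1: "S \<le> 1" using p1 by simp
      have "1 - S = (\<Sum>u\<in>nodes I. prob I i u * (1 - s u))"
        unfolding S_def by (simp add: right_diff_distrib sum_subtractf p1)
      also have "\<dots> = (\<Sum>j<num_nodes I. prob I i (Some j) * (1 - s (Some j)))"
        using s [of None] by (subst sum_nodes) (auto simp: nodes_def)
      also have "\<dots> \<le> (\<Sum>j<num_nodes I. prob I i (Some j) * r ^ n)"
      proof (intro sum_mono mult_left_mono)
        fix j assume "j \<in> {..<num_nodes I}"
        then have j: "Some j \<in> nodes I" by (auto simp: nodes_def)
        show "1 - s (Some j) \<le> r ^ n" using s [OF j] by linarith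
        show "0 \<le> prob I i (Some j)" using p [OF j] .
      qed
      also have "\<dots> \<le> r * r ^ n"
        unfolding sum_distrib_right [symmetric] r_def using r0 transient_row_sum_le [OF I i]
        by (intro mult_right_mono) (auto simp: r_def)
      finally have "1 - r ^ Suc n \<le> S" by simp
      then show ?thesis using S0 S1 eq Some by (intro exI [of _ S]) auto
    qed
  }
qed

lemma nn_integral_walk_prob:
  assumes I: "valid_bandit I" and r: "inf_norm_mat (transient_mat I) < 1" and v: "v \<in> nodes I"
  shows "(\<integral>\<^sup>+w. ennreal (walk_prob I v w) \<partial>count_space UNIV) = 1"
proof -
  define r where "r = inf_norm_mat (transient_mat I)"
  let ?f = "\<lambda>n w. ennreal (walk_prob I v w) * indicator {w. length w \<le> n} w"
  define P where "P n x \<longleftrightarrow> x \<le> 1 \<and> 1 - r ^ n \<le> x \<and> (\<integral>\<^sup>+w. ?f n w \<partial>count_space UNIV) = ennreal x"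
    for n x
  have "\<forall>n. \<exists>x. P n x"
    using walk_prob_truncated [OF I v] unfolding P_def r_def by blast
  then obtain s where "\<And>n. P n (s n)"
    by metis
  note s = this [unfolded P_def]
  have s1: "\<And>n. s n \<le> 1" and s2: "\<And>n. 1 - r ^ n \<le> s n"
    using s by blast+
  have i0: "0 < num_nodes I" using I by (auto simp: valid_bandit_def)
  have "0 \<le> (\<Sum>j<num_nodes I. prob I 0 (Some j))"
    using I i0 by (intro sum_nonneg) (auto simp: valid_bandit_def nodes_def)
  then have "0 \<le> r" using transient_row_sum_le [OF I i0] unfolding r_def by linarith
  then have "(\<lambda>n. 1 - r ^ n) \<longlonglongrightarrow> 1 - 0"
    using assms(2) unfolding r_def by (intro tendsto_intros LIMSEQ_realpow_zero) auto
  then have "s \<longlonglongrightarrow> 1"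
    by (intro tendsto_sandwich [of "\<lambda>n. 1 - r ^ n" s _ "\<lambda>_. 1"])
       (use s1 s2 in \<open>auto intro!: always_eventually\<close>)
  then have lim1: "(\<lambda>n. \<integral>\<^sup>+w. ?f n w \<partial>count_space UNIV) \<longlonglongrightarrow> 1"
    using s tendsto_ennrealI [of s 1] by simp
  have "(\<lambda>n. \<integral>\<^sup>+w. ?f n w \<partial>count_space UNIV)
      \<longlonglongrightarrow> (\<integral>\<^sup>+w. ennreal (walk_prob I v w) \<partial>count_space UNIV)"
  proof (rule nn_integral_LIMSEQ)
    show "incseq ?f"
      by (auto simp: incseq_def le_fun_def indicator_def)
    fix w :: "(real \<times> node) list"
    have "eventually (\<lambda>n. ?f n w = ennreal (walk_prob I v w)) sequentially"
      using eventually_ge_at_top [of "length w"] by eventually_elim auto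
    then show "(\<lambda>n. ?f n w) \<longlonglongrightarrow> ennreal (walk_prob I v w)"
      by (rule tendsto_eventually)
  qed auto
  with lim1 show ?thesis
    using LIMSEQ_unique by blast
qed

lemma pmf_walk:
  assumes "valid_bandit I" "inf_norm_mat (transient_mat I) < 1" "v \<in> nodes I"
  shows "pmf (walk I v) w = walk_prob I v w"
  unfolding walk_def
  by (rule pmf_embed_pmf) (use assms walk_prob_nonneg nn_integral_walk_prob in auto)

end

theory Submission
  imports Defs
begin

text \<open>
  Over all \<open>\<epsilon>\<close> the claimed bound, with \<open>r\<^sub>1 = r\<^sub>2 = 0\<close>, is at most \<open>sqrt T / 2\<close>, because
  \<open>exp (- u) \<le> 1 / (1 + u)\<close>. So for each \<open>T\<close> and \<open>\<pi>\<close> one instance with regret at least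
  \<open>sqrt T / 2\<close> serves every \<open>\<epsilon>\<close>. It is found among two mirror-image two-node instances whose
  per-step absorption probabilities are \<open>1/20 - \<delta>\<close> and \<open>1/20 + \<delta>\<close> with
  \<open>\<delta> = 1 / (40 * sqrt T)\<close>; since walks last about 20 steps, this yields
  a gap of order \<open>1 / sqrt T\<close> with a large enough constant. Le Cam's two-point method, in terms
  of the Hellinger affinity of the two history laws, bounds the sum of the two regrets: the
  affinity is multiplicative over epochs whatever the policy does, and for a single walk the
  first-step equations show that it is at least \<open>1 - O(\<delta>\<^sup>2)\<close>.
\<close>

section \<open>Hellinger affinity\<close>

text \<open>The Bhattacharyya coefficient. Values in \<open>ennreal\<close> avoid summability
  arguments when the integral runs over walks or histories.\<close>

definition affinity :: "'a pmf \<Rightarrow> 'a pmf \<Rightarrow> ennreal" where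
  "affinity p q = (\<integral>\<^sup>+x. ennreal (sqrt (pmf p x * pmf q x)) \<partial>count_space UNIV)"

lemma nn_integral_pmf_UNIV: "(\<integral>\<^sup>+x. ennreal (pmf p x) \<partial>count_space UNIV) = 1"
  by (simp add: nn_integral_pmf measure_pmf.emeasure_space_1 [of p, simplified])

lemma affinity_self [simp]: "affinity p p = 1"
  by (simp add: affinity_def nn_integral_pmf_UNIV)

lemma pmf_bind_Pair:
  "pmf (bind_pmf p (\<lambda>x. map_pmf (Pair x) (k x))) (x, y) = pmf p x * pmf (k x) y"
proof -
  have "pmf (map_pmf (Pair x') (k x')) (x, y) = pmf (k x) y * indicator {x} x'" for x'
  proof (cases "x' = x")
    case True
    then show ?thesis by (simp add: pmf_map_inj' inj_on_def)
  next
    case False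
    then have "(x, y) \<notin> set_pmf (map_pmf (Pair x') (k x'))" by auto
    then show ?thesis using False by (simp add: pmf_eq_0_set_pmf)
  qed
  then show ?thesis
    by (simp add: pmf_bind measure_pmf_single)
qed

lemma affinity_map_inj:
  assumes "inj f"
  shows "affinity (map_pmf f p) (map_pmf f q) = affinity p q"
proof -
  let ?s = "\<lambda>y. ennreal (sqrt (pmf (map_pmf f p) y * pmf (map_pmf f q) y))"
  have "?s y = 0" if "y \<notin> range f" for y
  proof -
    have "y \<notin> set_pmf (map_pmf f p)" using that by auto
    then show ?thesis by (simp add: pmf_eq_0_set_pmf)
  qed
  then have "affinity (map_pmf f p) (map_pmf f q) = (\<integral>\<^sup>+y. ?s y * indicator (range f) y \<partial>count_space UNIV)"
    unfolding affinity_def by (intro nn_integral_cong) (auto simp: indicator_def)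
  also have "\<dots> = (\<integral>\<^sup>+y. ?s y \<partial>count_space (range f))"
    by (simp add: nn_integral_count_space_indicator)
  also have "\<dots> = (\<integral>\<^sup>+x. ?s (f x) \<partial>count_space UNIV)"
    using assms by (intro nn_integral_bij_count_space [symmetric]) (simp add: bij_betw_def)
  finally show ?thesis
    using assms by (simp add: affinity_def pmf_map_inj')
qed

text \<open>Joint masses factor and the square root is multiplicative. Keeping the first component
  in the outcome is what gives an equality; forgetting it could increase the affinity.\<close>

lemma affinity_bind_Pair:
  "affinity (bind_pmf p (\<lambda>x. map_pmf (Pair x) (k x))) (bind_pmf q (\<lambda>x. map_pmf (Pair x) (l x))) =
   (\<integral>\<^sup>+x. ennreal (sqrt (pmf p x * pmf q x)) * affinity (k x) (l x) \<partial>count_space UNIV)"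
proof -
  have "sqrt (pmf p x * pmf (k x) y * (pmf q x * pmf (l x) y)) =
      sqrt (pmf p x * pmf q x) * sqrt (pmf (k x) y * pmf (l x) y)" for x y
    by (simp add: real_sqrt_mult [symmetric] mult_ac)
  then show ?thesis
    unfolding affinity_def
    by (subst nn_integral_fst_count_space [symmetric])
       (simp add: pmf_bind_Pair ennreal_mult nn_integral_cmult)
qed

text \<open>The arithmetic-geometric mean inequality at each point. It makes the affinities of walks
  finite, so that their equations can be solved in the reals.\<close>

lemma affinity_le_1: "affinity p q \<le> 1"
proof -
  define c :: real where "c = 1 / 2"
  have "sqrt (pmf p x * pmf q x) \<le> c * pmf p x + c * pmf q x" for x
    using arith_geo_mean_sqrt [of "pmf p x" "pmf q x"] by (simp add: c_def)
  then have "affinity p q \<le> (\<integral>\<^sup>+x. ennreal (c * pmf p x + c * pmf q x) \<partial>count_space UNIV)"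
    unfolding affinity_def by (intro nn_integral_mono ennreal_leI)
  also have "\<dots> = (\<integral>\<^sup>+x. ennreal c * ennreal (pmf p x) + ennreal c * ennreal (pmf q x) \<partial>count_space UNIV)"
    by (intro nn_integral_cong) (simp add: c_def ennreal_mult [symmetric] del: ennreal_half)
  also have "\<dots> = ennreal c + ennreal c"
    by (simp add: nn_integral_add nn_integral_cmult nn_integral_pmf_UNIV)
  also have "\<dots> = ennreal (c + c)"
    by (rule ennreal_plus [symmetric]) (simp_all add: c_def)
  finally show ?thesis by (simp add: c_def)
qed

section \<open>Le Cam's two-point bound\<close>

text \<open>Expand the square of \<open>sqrt p - b / 2 * sqrt q\<close>. This linear form stands in
  for Cauchy-Schwarz: summed over two laws with affinity \<open>A\<close> it gives
  \<open>b * A - b^2 / 2\<close>, which is largest at \<open>b = A\<close>.\<close>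

lemma min_ge_sqrt_mult:
  fixes p q b :: real
  assumes "0 \<le> p" "0 \<le> q"
  shows "b * sqrt (p * q) - b\<^sup>2 / 4 * (p + q) \<le> min p q"
proof -
  have *: "b * sqrt (p * q) - b\<^sup>2 / 4 * (p + q) \<le> p" if "0 \<le> p" "0 \<le> q" for p q
  proof -
    have "0 \<le> (sqrt p - b / 2 * sqrt q)\<^sup>2" by simp
    also have "\<dots> = p - b * sqrt (p * q) + b\<^sup>2 / 4 * q"
      using that by (simp add: power2_diff power_mult_distrib power_divide real_sqrt_mult)
    also have "\<dots> \<le> p - b * sqrt (p * q) + b\<^sup>2 / 4 * (p + q)"
      using that by (simp add: mult_left_mono)
    finally show ?thesis by simp
  qed
  show ?thesis
    using * [of p q] * [of q p] assms by (simp add: mult.commute add.commute)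
qed

text \<open>At each point the two weighted costs add up to at least \<open>c\<close> times the
  smaller mass, and \<open>min_ge_sqrt_mult\<close> bounds the total of the smaller masses from
  below. Off the common support the smaller mass is 0, so \<open>c\<close> has to bound
  \<open>f + g\<close> only on it.\<close>

lemma le_cam_two_point:
  fixes f g :: "'a \<Rightarrow> real"
  assumes b: "0 \<le> b" "ennreal b \<le> affinity p q"
    and c: "0 \<le> c" "\<And>x. x \<in> set_pmf p \<Longrightarrow> x \<in> set_pmf q \<Longrightarrow> c \<le> f x + g x"
    and f: "integrable p f" "\<And>x. x \<in> set_pmf p \<Longrightarrow> 0 \<le> f x"
    and g: "integrable q g" "\<And>x. x \<in> set_pmf q \<Longrightarrow> 0 \<le> g x"
  shows "c * b\<^sup>2 / 2 \<le> measure_pmf.expectation p f + measure_pmf.expectation q g"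
proof -
  let ?E = "measure_pmf.expectation p f" and ?F = "measure_pmf.expectation q g"
  have E0: "0 \<le> ?E" "0 \<le> ?F"
    using f g by (auto intro!: integral_nonneg_AE simp: AE_measure_pmf_iff)
  \<comment> \<open>The negative term of \<open>min_ge_sqrt_mult\<close> is moved to the right,
    since subtraction in \<open>ennreal\<close> truncates.\<close>
  have pointwise: "ennreal (c * b) * ennreal (sqrt (pmf p x * pmf q x)) \<le>
      ennreal (pmf p x) * ennreal (f x) + ennreal (pmf q x) * ennreal (g x)
      + ennreal (c * b\<^sup>2 / 4) * (ennreal (pmf p x) + ennreal (pmf q x))" for x
  proof (cases "x \<in> set_pmf p \<and> x \<in> set_pmf q")
    case True
    then have fg: "0 \<le> f x" "0 \<le> g x" "c \<le> f x + g x" using c f g by auto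
    have "c * b * sqrt (pmf p x * pmf q x) - c * b\<^sup>2 / 4 * (pmf p x + pmf q x)
        \<le> c * min (pmf p x) (pmf q x)"
      using mult_left_mono [OF min_ge_sqrt_mult [of "pmf p x" "pmf q x" b] c(1)]
      by (simp add: algebra_simps)
    also have "\<dots> \<le> (f x + g x) * min (pmf p x) (pmf q x)"
      using fg by (intro mult_right_mono) auto
    also have "\<dots> = f x * min (pmf p x) (pmf q x) + g x * min (pmf p x) (pmf q x)"
      by (simp add: distrib_right)
    also have "\<dots> \<le> f x * pmf p x + g x * pmf q x"
      using fg by (intro add_mono mult_left_mono) auto
    finally show ?thesis
      using b c fg
      by (simp flip: ennreal_mult ennreal_plus add: ennreal_le_iff mult.commute)
  next
    case False
    then have "pmf p x = 0 \<or> pmf q x = 0" by (auto simp: pmf_eq_0_set_pmf)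
    then show ?thesis by auto
  qed
  \<comment> \<open>Both laws have total mass 1, so the correction integrates to
    \<open>d + d\<close>, which is half of the main term \<open>c * b * b\<close>.\<close>
  define d where "d = c * b\<^sup>2 / 4"
  have d0: "0 \<le> d" using c by (simp add: d_def)
  have "ennreal (c * b * b) \<le> ennreal (c * b) * affinity p q"
    using b c by (simp add: ennreal_mult mult_left_mono)
  also have "\<dots> = (\<integral>\<^sup>+x. ennreal (c * b) * ennreal (sqrt (pmf p x * pmf q x)) \<partial>count_space UNIV)"
    by (simp add: affinity_def nn_integral_cmult)
  also have "\<dots> \<le> (\<integral>\<^sup>+x. ennreal (pmf p x) * ennreal (f x) + ennreal (pmf q x) * ennreal (g x)
      + ennreal (c * b\<^sup>2 / 4) * (ennreal (pmf p x) + ennreal (pmf q x)) \<partial>count_space UNIV)"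
    using pointwise by (rule nn_integral_mono)
  also have "\<dots> = (\<integral>\<^sup>+x. f x \<partial>p) + (\<integral>\<^sup>+x. g x \<partial>q) + (ennreal d + ennreal d)"
    by (simp add: nn_integral_add nn_integral_cmult nn_integral_pmf_UNIV nn_integral_measure_pmf
        distrib_left d_def)
  also have "\<dots> = ennreal ?E + ennreal ?F + (ennreal d + ennreal d)"
    using f g by (simp add: nn_integral_eq_integral AE_measure_pmf_iff)
  also have "\<dots> = ennreal (?E + ?F + (d + d))"
    using E0 d0 by (simp flip: ennreal_plus)
  finally have "c * b * b \<le> ?E + ?F + (d + d)"
    using E0 d0 by (subst (asm) ennreal_le_iff) auto
  then have "c * b * b \<le> ?E + ?F + c * b\<^sup>2 / 2" by (simp add: d_def)
  then show ?thesis by (simp add: power2_eq_square)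
qed

section \<open>Affinity of history laws\<close>

text \<open>Brings one epoch into the form of an injective image of two nested pairings, to which
  \<open>affinity_map_inj\<close> and \<open>affinity_bind_Pair\<close> apply.\<close>

lemma history_pmf_Suc_pairs:
  "history_pmf I \<pi> (Suc t) = map_pmf (\<lambda>(h, \<tau>). h @ [\<tau>])
     (bind_pmf (history_pmf I \<pi> t) (\<lambda>h. map_pmf (Pair h)
       (bind_pmf (\<pi> (num_nodes I) h) (\<lambda>j. map_pmf (Pair j) (walk I (Some j))))))"
  by (simp add: map_bind_pmf bind_map_pmf map_pmf_comp trajectory_pmf_def)

text \<open>Given the history, the policy draws the next node from the same law under both
  instances, so this draw loses no affinity. An epoch then contributes an average of single-walk
  affinities, which is at least \<open>b\<close> for every history, however adaptive the policy
  is.\<close>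

lemma affinity_history:
  assumes \<pi>: "valid_policy \<pi>" and K: "num_nodes I = K" "num_nodes J = K" "1 \<le> K"
    and b: "\<And>j. j < K \<Longrightarrow> b \<le> affinity (walk I (Some j)) (walk J (Some j))"
  shows "b ^ t \<le> affinity (history_pmf I \<pi> t) (history_pmf J \<pi> t)"
proof (induction t)
  case (Suc t)
  have step: "b \<le> (\<integral>\<^sup>+j. ennreal (pmf (\<pi> K h) j) * affinity (walk I (Some j)) (walk J (Some j)) \<partial>count_space UNIV)"
    for h
  proof -
    have "b = (\<integral>\<^sup>+j. ennreal (pmf (\<pi> K h) j) * b \<partial>count_space UNIV)"
      by (simp add: nn_integral_multc nn_integral_pmf_UNIV)
    also have "\<dots> \<le> (\<integral>\<^sup>+j. ennreal (pmf (\<pi> K h) j) * affinity (walk I (Some j)) (walk J (Some j)) \<partial>count_space UNIV)"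
    proof (intro nn_integral_mono)
      fix j
      \<comment> \<open>The bound \<open>b\<close> is known only for actual nodes; a valid policy
        gives all other indices mass 0.\<close>
      have "j < K" if "pmf (\<pi> K h) j \<noteq> 0"
      proof -
        have "set_pmf (\<pi> K h) \<subseteq> {..<K}" using \<pi> K(3) unfolding valid_policy_def by blast
        then show ?thesis using that by (auto simp: set_pmf_iff)
      qed
      then show "ennreal (pmf (\<pi> K h) j) * b \<le>
          ennreal (pmf (\<pi> K h) j) * affinity (walk I (Some j)) (walk J (Some j))"
        using b [of j] by (cases "pmf (\<pi> K h) j = 0") (auto intro: mult_left_mono)
    qed
    finally show ?thesis .
  qed
  have "b ^ Suc t \<le> affinity (history_pmf I \<pi> t) (history_pmf J \<pi> t) * b"
    using Suc.IH by (simp add: mult.commute mult_left_mono)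
  also have "\<dots> = (\<integral>\<^sup>+h. ennreal (sqrt (pmf (history_pmf I \<pi> t) h * pmf (history_pmf J \<pi> t) h)) * b
      \<partial>count_space UNIV)"
    by (simp add: affinity_def nn_integral_multc)
  also have "\<dots> \<le> affinity (history_pmf I \<pi> (Suc t)) (history_pmf J \<pi> (Suc t))"
    unfolding history_pmf_Suc_pairs K
    by (subst affinity_map_inj)
       (auto simp: inj_on_def affinity_bind_Pair intro!: nn_integral_mono mult_left_mono step)
  finally show ?case .
qed simp

lemma set_history_pmf:
  assumes \<pi>: "valid_policy \<pi>" and K: "1 \<le> num_nodes I" and h: "h \<in> set_pmf (history_pmf I \<pi> t)"
  shows "length h = t \<and> (\<forall>\<tau>\<in>set h. fst \<tau> < num_nodes I)"
  using h
proof (induction t arbitrary: h)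
  case (Suc t)
  then obtain h' j \<tau> where "h' \<in> set_pmf (history_pmf I \<pi> t)" "j \<in> set_pmf (\<pi> (num_nodes I) h')"
    "fst \<tau> = j" "h = h' @ [\<tau>]"
    by (auto simp: trajectory_pmf_def)
  moreover from this have "j < num_nodes I"
    using \<pi> K by (auto simp: valid_policy_def)
  ultimately show ?case using Suc.IH [of h'] by auto
qed simp

section \<open>First-step equations\<close>

lemma mult_sqrt_divide:
  fixes a b :: real
  assumes "0 \<le> a"
  shows "a * sqrt (b / a) = sqrt (a * b)"
proof (cases "a = 0")
  case False
  then have "a * b = a\<^sup>2 * (b / a)" by (simp add: power2_eq_square)
  then show ?thesis using assms by (simp add: real_sqrt_mult del: times_divide_eq_right)
qed simp

text \<open>A first-step equation whose transition weights are geometric means. Equal edge lengths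
  ensure that a transition is recorded by the same pair under both instances.\<close>

lemma affinity_walk_step:
  assumes I: "valid_bandit I" "inf_norm_mat (transient_mat I) < 1"
    and J: "valid_bandit J" "inf_norm_mat (transient_mat J) < 1"
    and K: "num_nodes J = num_nodes I" and i: "i < num_nodes I"
    and len: "len J = len I"
  shows "affinity (walk I (Some i)) (walk J (Some i)) =
    (\<Sum>v\<in>nodes I. ennreal (sqrt (prob I i v * prob J i v)) * affinity (walk I v) (walk J v))"
proof -
  have nodes: "nodes J = nodes I" using K by (simp add: nodes_def)
  \<comment> \<open>\<open>nn_integral_walk_step\<close> integrates against one walk law, so the
    geometric mean is written as that law times the root of the likelihood ratio. Where the first
    law is 0 both sides vanish, whatever the quotient is.\<close>
  define g where "g v w = sqrt (walk_prob J v w / walk_prob I v w)" for v w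
  have g: "ennreal (sqrt (walk_prob I v w * walk_prob J v w)) =
      ennreal (walk_prob I v w) * ennreal (g v w)" if "v \<in> nodes I" for v w
  proof -
    have *: "0 \<le> walk_prob I v w" "0 \<le> walk_prob J v w"
      using walk_prob_nonneg [OF I(1) that] walk_prob_nonneg [OF J(1)] that nodes by auto
    have "sqrt (walk_prob I v w * walk_prob J v w) = walk_prob I v w * g v w"
      using * by (simp add: g_def mult_sqrt_divide)
    then show ?thesis using * by (simp add: ennreal_mult g_def)
  qed
  have aff: "affinity (walk I v) (walk J v) =
      (\<integral>\<^sup>+w. ennreal (walk_prob I v w) * ennreal (g v w) \<partial>count_space UNIV)" if "v \<in> nodes I" for v
    using that nodes g by (simp add: affinity_def pmf_walk I J)
  have Si: "Some i \<in> nodes I" using i by (simp add: nodes_def)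
  have "affinity (walk I (Some i)) (walk J (Some i)) =
     (\<Sum>v\<in>nodes I. ennreal (prob I i v) * (\<integral>\<^sup>+w. ennreal (walk_prob I v w) *
        ennreal (g (Some i) ((len I i v, v) # w)) \<partial>count_space UNIV))"
    unfolding aff [OF Si] by (rule nn_integral_walk_step [OF I(1) i])
  also have "\<dots> = (\<Sum>v\<in>nodes I. ennreal (sqrt (prob I i v * prob J i v)) * affinity (walk I v) (walk J v))"
  proof (rule sum.cong [OF refl])
    fix v assume v: "v \<in> nodes I"
    have p: "0 \<le> prob I i v" "0 \<le> prob J i v"
      using I(1) J(1) K i v nodes by (auto simp: valid_bandit_def)
    \<comment> \<open>The likelihood ratio is multiplicative along the walk, so its first factor
      splits off.\<close>
    have G: "g (Some i) ((len I i v, v) # w) = sqrt (prob J i v / prob I i v) * g v w" for w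
      using v nodes len by (simp add: g_def real_sqrt_mult [symmetric])
    have "0 \<le> g v w" for w
      using walk_prob_nonneg [OF I(1) v] walk_prob_nonneg [OF J(1)] v nodes
      by (simp add: g_def)
    then have "(\<integral>\<^sup>+w. ennreal (walk_prob I v w) *
        ennreal (g (Some i) ((len I i v, v) # w)) \<partial>count_space UNIV) =
        ennreal (sqrt (prob J i v / prob I i v)) * affinity (walk I v) (walk J v)"
      unfolding G aff [OF v] using p
      by (simp add: ennreal_mult mult_ac nn_integral_cmult [symmetric])
    moreover have "prob I i v * sqrt (prob J i v / prob I i v) = sqrt (prob I i v * prob J i v)"
      using p by (simp add: mult_sqrt_divide)
    ultimately show "ennreal (prob I i v) * (\<integral>\<^sup>+w. ennreal (walk_prob I v w) *
        ennreal (g (Some i) ((len I i v, v) # w)) \<partial>count_space UNIV) =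
        ennreal (sqrt (prob I i v * prob J i v)) * affinity (walk I v) (walk J v)"
      using p by (simp add: mult.assoc [symmetric] ennreal_mult [symmetric])
  qed
  finally show ?thesis .
qed

section \<open>Expected length, mean reward and visits of a walk\<close>

lemma nn_integral_walk_None:
  "(\<integral>\<^sup>+w. ennreal (walk_prob I None w) * g w \<partial>count_space UNIV) = g []"
  by (subst nn_integral_count_space' [of "{[]}"]) auto

lemma nn_integral_walk_length:
  \<comment> \<open>The bound is the fixed point of \<open>x = 1 + r * x\<close>. The first-step
    relation alone would also allow an infinite value, so lengths are first truncated at
    \<open>n\<close>, bounded by induction, and then monotone convergence is applied.\<close>
  assumes I: "valid_bandit I" and r: "inf_norm_mat (transient_mat I) = r" "r < 1" and v: "v \<in> nodes I"
  shows "(\<integral>\<^sup>+w. ennreal (walk_prob I v w) * ennreal (length w) \<partial>count_space UNIV) \<le> ennreal (1 / (1 - r))"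
proof -
  let ?F = "\<lambda>n v. \<integral>\<^sup>+w. ennreal (walk_prob I v w) * ennreal (real (min n (length w))) \<partial>count_space UNIV"
  have bound: "?F n v \<le> ennreal (1 / (1 - r))" if "v \<in> nodes I" for n v
    using that
  proof (induction n arbitrary: v)
    case 0
    then show ?case by simp
  next
    case (Suc n)
    show ?case
    proof (cases v)
      case None
      then show ?thesis by (simp add: nn_integral_walk_None del: walk_prob.simps)
    next
      case (Some i)
      then have i: "i < num_nodes I" using Suc.prems by (auto simp: nodes_def)
      have p: "\<And>u. u \<in> nodes I \<Longrightarrow> 0 \<le> prob I i u" and p1: "(\<Sum>u\<in>nodes I. prob I i u) = 1"
        using I i by (auto simp: valid_bandit_def)
      have F0: "?F n None = 0" by (simp add: nn_integral_walk_None del: walk_prob.simps)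
      have "?F (Suc n) v = (\<Sum>u\<in>nodes I. ennreal (prob I i u) * (\<integral>\<^sup>+w. ennreal (walk_prob I u w) *
          ennreal (real (min (Suc n) (length ((len I i u, u) # w)))) \<partial>count_space UNIV))"
        unfolding Some by (rule nn_integral_walk_step [OF I i])
      also have "\<dots> = (\<Sum>u\<in>nodes I. ennreal (prob I i u) * (1 + ?F n u))"
      proof (intro sum.cong refl)
        fix u assume u: "u \<in> nodes I"
        have "(\<integral>\<^sup>+w. ennreal (walk_prob I u w) *
            ennreal (real (min (Suc n) (length ((len I i u, u) # w)))) \<partial>count_space UNIV) =
          (\<integral>\<^sup>+w. ennreal (walk_prob I u w) +
             ennreal (walk_prob I u w) * ennreal (real (min n (length w))) \<partial>count_space UNIV)"
          by (intro nn_integral_cong) (simp add: distrib_left)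
        also have "\<dots> = 1 + ?F n u"
          using nn_integral_walk_prob [OF I _ u] r by (simp add: nn_integral_add)
        finally show "ennreal (prob I i u) * (\<integral>\<^sup>+w. ennreal (walk_prob I u w) *
            ennreal (real (min (Suc n) (length ((len I i u, u) # w)))) \<partial>count_space UNIV) =
            ennreal (prob I i u) * (1 + ?F n u)" by simp
      qed
      also have "\<dots> = (\<Sum>u\<in>nodes I. ennreal (prob I i u)) + (\<Sum>u\<in>nodes I. ennreal (prob I i u) * ?F n u)"
        by (simp add: distrib_left sum.distrib)
      also have "(\<Sum>u\<in>nodes I. ennreal (prob I i u)) = 1"
        using p p1 by (simp add: sum_ennreal)
      also have "(\<Sum>u\<in>nodes I. ennreal (prob I i u) * ?F n u) =
          (\<Sum>j<num_nodes I. ennreal (prob I i (Some j)) * ?F n (Some j))"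
        unfolding sum_nodes F0 by simp
      also have "\<dots> \<le> (\<Sum>j<num_nodes I. ennreal (prob I i (Some j)) * ennreal (1 / (1 - r)))"
        by (intro sum_mono mult_left_mono Suc.IH) (auto simp: nodes_def)
      also have "\<dots> = ennreal ((\<Sum>j<num_nodes I. prob I i (Some j)) * (1 / (1 - r)))"
      proof -
        have "(\<Sum>j<num_nodes I. ennreal (prob I i (Some j))) = ennreal (\<Sum>j<num_nodes I. prob I i (Some j))"
          using p by (intro sum_ennreal) (auto simp: nodes_def)
        then show ?thesis
          unfolding sum_distrib_right [symmetric] using r by (subst ennreal_mult'') auto
      qed
      also have "\<dots> \<le> ennreal (r * (1 / (1 - r)))"
        using transient_row_sum_le [OF I i] r by (intro ennreal_leI mult_right_mono) auto
      finally have "?F (Suc n) v \<le> 1 + ennreal (r * (1 / (1 - r)))"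
        by (simp add: add_left_mono)
      moreover have "0 \<le> r"
      proof -
        have "0 \<le> (\<Sum>j<num_nodes I. prob I i (Some j))"
          using p by (intro sum_nonneg) (auto simp: nodes_def)
        then show ?thesis using transient_row_sum_le [OF I i] r by simp
      qed
      then have "1 + ennreal (r * (1 / (1 - r))) = ennreal (1 / (1 - r))"
        using r by (simp flip: ennreal_1 ennreal_plus add: field_simps)
      ultimately show ?thesis by simp
    qed
  qed
  have "(\<integral>\<^sup>+w. ennreal (walk_prob I v w) * ennreal (length w) \<partial>count_space UNIV) =
      (\<integral>\<^sup>+w. (SUP n. ennreal (walk_prob I v w) * ennreal (real (min n (length w)))) \<partial>count_space UNIV)"
  proof (intro nn_integral_cong antisym)
    fix w :: "(real \<times> node) list"
    show "ennreal (walk_prob I v w) * ennreal (length w) \<le>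
        (SUP n. ennreal (walk_prob I v w) * ennreal (real (min n (length w))))"
      by (rule SUP_upper2 [of "length w"]) auto
    show "(SUP n. ennreal (walk_prob I v w) * ennreal (real (min n (length w)))) \<le>
        ennreal (walk_prob I v w) * ennreal (length w)"
      by (intro SUP_least mult_left_mono ennreal_leI) auto
  qed
  also have "\<dots> = (SUP n. ?F n v)"
    by (intro nn_integral_monotone_convergence_SUP)
       (auto simp: incseq_def le_fun_def intro!: mult_left_mono ennreal_leI)
  also have "\<dots> \<le> ennreal (1 / (1 - r))"
    using bound [OF v] by (intro SUP_least) auto
  finally show ?thesis .
qed

text \<open>Restricted to lists of nonzero probability, because an arbitrary list may carry any real
  numbers as lengths.\<close>

lemma walk_reward_bounds:
  assumes I: "valid_bandit I" and v: "v \<in> nodes I" and w: "walk_prob I v w \<noteq> 0"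
  shows "0 \<le> sum_list (map fst w)" "sum_list (map fst w) \<le> length w"
proof -
  have "0 \<le> sum_list (map fst w) \<and> sum_list (map fst w) \<le> length w"
    using v w
  proof (induction w arbitrary: v)
    case (Cons a w)
    obtain i where i: "v = Some i" "i < num_nodes I"
      using Cons.prems by (cases v) (auto simp: nodes_def)
    obtain x u where a: "a = (x, u)" by fastforce
    have "u \<in> nodes I" "x = len I i u" "walk_prob I u w \<noteq> 0"
      using Cons.prems(2) by (auto simp: i a split: if_splits)
    moreover from this have "0 \<le> x" "x \<le> 1"
      using I i by (auto simp: valid_bandit_def)
    ultimately show ?case using Cons.IH [of u] by (auto simp: a)
  qed simp
  then show "0 \<le> sum_list (map fst w)" "sum_list (map fst w) \<le> length w" by auto
qed

lemma mean_reward_step: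
  assumes I: "valid_bandit I" and r: "inf_norm_mat (transient_mat I) < 1" and i: "i < num_nodes I"
  shows "mean_reward I i =
    (\<Sum>v\<in>nodes I. prob I i v * len I i v) + (\<Sum>j<num_nodes I. prob I i (Some j) * mean_reward I j)"
proof -
  let ?R = "\<lambda>w. sum_list (map fst w)"
  define m where "m v = (\<integral>\<^sup>+w. ennreal (walk_prob I v w) * ennreal (?R w) \<partial>count_space UNIV)" for v
  \<comment> \<open>The reward is at most the number of steps. Finiteness matters because
    \<open>enn2real\<close> would send an infinite mean to 0.\<close>
  have m_fin: "m v \<noteq> \<top>" if v: "v \<in> nodes I" for v
  proof -
    have "m v \<le> (\<integral>\<^sup>+w. ennreal (walk_prob I v w) * ennreal (length w) \<partial>count_space UNIV)"
      unfolding m_def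
    proof (intro nn_integral_mono)
      fix w
      show "ennreal (walk_prob I v w) * ennreal (?R w) \<le> ennreal (walk_prob I v w) * ennreal (length w)"
        using walk_reward_bounds [OF I v, of w]
        by (cases "walk_prob I v w = 0") (auto intro!: mult_left_mono ennreal_leI)
    qed
    also have "\<dots> \<le> ennreal (1 / (1 - inf_norm_mat (transient_mat I)))"
      by (rule nn_integral_walk_length [OF I refl r v])
    finally show ?thesis by (auto simp: top_unique)
  qed
  have mean: "ennreal (mean_reward I j) = m (Some j)" "0 \<le> mean_reward I j" if j: "j < num_nodes I" for j
  proof -
    have v: "Some j \<in> nodes I" using j by (simp add: nodes_def)
    have "mean_reward I j = measure_pmf.expectation (walk I (Some j)) ?R"
      by (simp add: mean_reward_def trajectory_pmf_def reward_def)
    also have "\<dots> = enn2real (\<integral>\<^sup>+w. ennreal (?R w) \<partial>walk I (Some j))"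
      using walk_reward_bounds [OF I v]
      by (intro integral_eq_nn_integral) (auto simp: AE_measure_pmf_iff set_pmf_iff pmf_walk [OF I r v])
    also have "\<dots> = enn2real (m (Some j))"
      by (simp add: nn_integral_measure_pmf m_def pmf_walk [OF I r v])
    finally show "ennreal (mean_reward I j) = m (Some j)" "0 \<le> mean_reward I j"
      using m_fin [OF v] by (auto simp: less_top)
  qed
  have p: "\<And>u. u \<in> nodes I \<Longrightarrow> 0 \<le> prob I i u" and l: "\<And>u. u \<in> nodes I \<Longrightarrow> 0 \<le> len I i u"
    using I i by (auto simp: valid_bandit_def)
  have "m (Some i) = (\<Sum>v\<in>nodes I. ennreal (prob I i v) *
      (\<integral>\<^sup>+w. ennreal (walk_prob I v w) * ennreal (?R ((len I i v, v) # w)) \<partial>count_space UNIV))"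
    unfolding m_def by (rule nn_integral_walk_step [OF I i])
  also have "\<dots> = (\<Sum>v\<in>nodes I. ennreal (prob I i v) * (ennreal (len I i v) + m v))"
  proof (intro sum.cong refl)
    fix v assume v: "v \<in> nodes I"
    have "(\<integral>\<^sup>+w. ennreal (walk_prob I v w) * ennreal (?R ((len I i v, v) # w)) \<partial>count_space UNIV) =
        (\<integral>\<^sup>+w. ennreal (walk_prob I v w) * ennreal (len I i v) +
           ennreal (walk_prob I v w) * ennreal (?R w) \<partial>count_space UNIV)"
    proof (intro nn_integral_cong)
      fix w
      show "ennreal (walk_prob I v w) * ennreal (?R ((len I i v, v) # w)) =
          ennreal (walk_prob I v w) * ennreal (len I i v) + ennreal (walk_prob I v w) * ennreal (?R w)"
        using walk_reward_bounds [OF I v, of w] l [OF v]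
        by (cases "walk_prob I v w = 0") (auto simp: distrib_left)
    qed
    also have "\<dots> = ennreal (len I i v) + m v"
      using nn_integral_walk_prob [OF I r v] by (simp add: nn_integral_add nn_integral_multc m_def)
    finally show "ennreal (prob I i v) * (\<integral>\<^sup>+w. ennreal (walk_prob I v w) *
        ennreal (?R ((len I i v, v) # w)) \<partial>count_space UNIV) =
        ennreal (prob I i v) * (ennreal (len I i v) + m v)" by simp
  qed
  also have "\<dots> = (\<Sum>v\<in>nodes I. ennreal (prob I i v * len I i v)) + (\<Sum>v\<in>nodes I. ennreal (prob I i v) * m v)"
    unfolding distrib_left sum.distrib using p l by (simp add: ennreal_mult)
  also have "(\<Sum>v\<in>nodes I. ennreal (prob I i v) * m v) =
      (\<Sum>j<num_nodes I. ennreal (prob I i (Some j) * mean_reward I j))"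
  proof -
    have "m None = 0" by (simp add: m_def nn_integral_walk_None del: walk_prob.simps)
    then have "(\<Sum>v\<in>nodes I. ennreal (prob I i v) * m v) =
        (\<Sum>j<num_nodes I. ennreal (prob I i (Some j)) * m (Some j))"
      by (simp add: sum_nodes)
    also have "\<dots> = (\<Sum>j<num_nodes I. ennreal (prob I i (Some j) * mean_reward I j))"
      using p by (intro sum.cong refl) (auto simp: mean(1) [symmetric] ennreal_mult mean(2) nodes_def)
    finally show ?thesis .
  qed
  finally have "ennreal (mean_reward I i) =
      (\<Sum>v\<in>nodes I. ennreal (prob I i v * len I i v)) + (\<Sum>j<num_nodes I. ennreal (prob I i (Some j) * mean_reward I j))"
    using mean i by simp
  also have "\<dots> = ennreal ((\<Sum>v\<in>nodes I. prob I i v * len I i v) + (\<Sum>j<num_nodes I. prob I i (Some j) * mean_reward I j))"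
  proof -
    have a: "0 \<le> prob I i v * len I i v" if "v \<in> nodes I" for v
      using p l that by simp
    have b: "0 \<le> prob I i (Some j) * mean_reward I j" if "j < num_nodes I" for j
      using p mean(2) that by (auto simp: nodes_def)
    have "(\<Sum>v\<in>nodes I. ennreal (prob I i v * len I i v)) = ennreal (\<Sum>v\<in>nodes I. prob I i v * len I i v)"
      "(\<Sum>j<num_nodes I. ennreal (prob I i (Some j) * mean_reward I j)) =
        ennreal (\<Sum>j<num_nodes I. prob I i (Some j) * mean_reward I j)"
      using a b by (auto intro!: sum_ennreal)
    then show ?thesis
      using a b by (simp only:) (intro ennreal_plus [symmetric] sum_nonneg; simp)
  qed
  finally show ?thesis
    using mean(2) [OF i] p l mean(2)
    by (subst (asm) ennreal_inj) (auto intro!: add_nonneg_nonneg sum_nonneg simp: nodes_def)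
qed

text \<open>Of the first-step decomposition of the visiting event only the summand that moves
  directly to \<open>j\<close> is kept.\<close>

lemma visit_prob_ge_prob:
  assumes I: "valid_bandit I" and r: "inf_norm_mat (transient_mat I) < 1"
    and i: "i < num_nodes I" and j: "j < num_nodes I"
  shows "prob I i (Some j) \<le> visit_prob I i j"
proof -
  let ?A = "{w. Some j \<in> visited (i, w)}"
  have v: "Some i \<in> nodes I" "Some j \<in> nodes I" using i j by (auto simp: nodes_def)
  have "ennreal (prob I i (Some j)) = ennreal (prob I i (Some j)) *
      (\<integral>\<^sup>+w. ennreal (walk_prob I (Some j) w) * indicator ?A ((len I i (Some j), Some j) # w) \<partial>count_space UNIV)"
    using nn_integral_walk_prob [OF I r v(2)] by (simp add: visited_def)
  also have "\<dots> \<le> (\<Sum>u\<in>nodes I. ennreal (prob I i u) *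
      (\<integral>\<^sup>+w. ennreal (walk_prob I u w) * indicator ?A ((len I i u, u) # w) \<partial>count_space UNIV))"
    using v(2) by (intro member_le_sum) auto
  also have "\<dots> = (\<integral>\<^sup>+w. ennreal (walk_prob I (Some i) w) * indicator ?A w \<partial>count_space UNIV)"
    by (rule nn_integral_walk_step [OF I i, symmetric])
  also have "\<dots> = emeasure (walk I (Some i)) ?A"
    by (simp add: nn_integral_indicator [symmetric] nn_integral_measure_pmf pmf_walk [OF I r v(1)] del: nn_integral_indicator)
  also have "\<dots> = ennreal (visit_prob I i j)"
    by (simp add: visit_prob_def trajectory_pmf_def measure_map_pmf vimage_def measure_pmf.emeasure_eq_measure)
  finally show ?thesis
    by (simp add: visit_prob_def)
qed

section \<open>A two-node family\<close>

text \<open>Unit lengths make the reward the absorption time, so \<open>b\<close> is the better node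
  for positive \<open>\<delta>\<close>. Moving mass between staying and absorption leaves the
  crossing probability at 1/20.\<close>

definition two_node :: "real \<Rightarrow> nat \<Rightarrow> rw_bandit" where
  "two_node \<delta> b = \<lparr>num_nodes = 2,
     prob = (\<lambda>i v. let s = (if i = b then \<delta> else - \<delta>) in
       case v of None \<Rightarrow> 1/20 - s | Some j \<Rightarrow> if j = i then 9/10 + s else 1/20),
     len = (\<lambda>_ _. 1)\<rparr>"

lemma two_node_sel [simp]:
  "num_nodes (two_node \<delta> b) = 2"
  "len (two_node \<delta> b) i v = 1"
  "prob (two_node \<delta> b) i None = 1/20 - (if i = b then \<delta> else - \<delta>)"
  "prob (two_node \<delta> b) i (Some j) = (if j = i then 9/10 + (if i = b then \<delta> else - \<delta>) else 1/20)"
  by (simp_all add: two_node_def Let_def)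

lemma lessThan_2_nat: "{..<2::nat} = {0, 1}"
  by auto

lemma less_2_nat: "i < (2::nat) \<longleftrightarrow> i = 0 \<or> i = 1"
  by auto

lemma nodes_two_node: "nodes (two_node \<delta> b) = {None, Some 0, Some 1}"
  by (auto simp: nodes_def lessThan_2_nat)

lemma two_node_valid:
  assumes "0 \<le> \<delta>" "\<delta> \<le> 1/40"
  shows "valid_bandit (two_node \<delta> b)"
  using assms by (auto simp: valid_bandit_def nodes_two_node less_2_nat)

lemma two_node_primitive:
  assumes "0 \<le> \<delta>" "\<delta> \<le> 1/40"
  shows "primitive_mat (transient_mat (two_node \<delta> b))"
  unfolding primitive_mat_def using assms
  by (intro exI [of _ 1]) (auto simp: transient_mat_def less_2_nat)

lemma two_node_inf_norm:
  assumes "0 \<le> \<delta>" "\<delta> \<le> 1/40"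
  shows "inf_norm_mat (transient_mat (two_node \<delta> b)) \<le> 39/40"
  using assms by (auto simp: inf_norm_mat_def transient_mat_def lessThan_2_nat)

lemma two_node_mean:
  assumes \<delta>: "0 \<le> \<delta>" "\<delta> \<le> 1/40" and b: "b < 2" and i: "i < 2" and ib: "i \<noteq> b"
  shows "mean_reward (two_node \<delta> b) b - mean_reward (two_node \<delta> b) i = 2 * \<delta> / (3/400 - \<delta>\<^sup>2)"
proof -
  let ?m = "mean_reward (two_node \<delta> b)"
  have r: "inf_norm_mat (transient_mat (two_node \<delta> b)) < 1"
    using two_node_inf_norm [OF \<delta>, of b] by simp
  have m: "?m j = 1 + (\<Sum>k<2. prob (two_node \<delta> b) j (Some k) * ?m k)" if "j < 2" for j
    using mean_reward_step [OF two_node_valid [OF \<delta>] r] two_node_valid [OF \<delta>, of b] that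
    by (simp add: valid_bandit_def)
  have sums: "(\<Sum>k<2. prob (two_node \<delta> b) b (Some k) * ?m k) = (9/10 + \<delta>) * ?m b + 1/20 * ?m i"
    "(\<Sum>k<2. prob (two_node \<delta> b) i (Some k) * ?m k) = (9/10 - \<delta>) * ?m i + 1/20 * ?m b"
    using b i ib by (auto simp: less_2_nat lessThan_2_nat)
  \<comment> \<open>The factor on the left is the determinant of the identity minus the transient
    matrix. The coefficients are the difference of the two rows of its adjugate; they add up to
    \<open>2 * \<delta>\<close>, and both brackets equal 1.\<close>
  have "(3/400 - \<delta>\<^sup>2) * (?m b - ?m i) =
      (\<delta> + 1/20) * (?m b - ((9/10 + \<delta>) * ?m b + 1/20 * ?m i)) +
      (\<delta> - 1/20) * (?m i - ((9/10 - \<delta>) * ?m i + 1/20 * ?m b))"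
    by (simp add: field_simps power2_eq_square)
  also have "?m b - ((9/10 + \<delta>) * ?m b + 1/20 * ?m i) = 1"
    using m [OF b] unfolding sums by linarith
  also have "?m i - ((9/10 - \<delta>) * ?m i + 1/20 * ?m b) = 1"
    using m [OF i] unfolding sums by linarith
  finally have "(3/400 - \<delta>\<^sup>2) * (?m b - ?m i) = 2 * \<delta>" by simp
  moreover have "\<delta>\<^sup>2 \<le> (1/40)\<^sup>2" using \<delta> by (intro power_mono) auto
  then have "0 < 3/400 - \<delta>\<^sup>2" by (simp add: power2_eq_square)
  ultimately show ?thesis by (simp add: field_simps)
qed

lemma two_node_regret:
  assumes \<delta>: "0 \<le> \<delta>" "\<delta> \<le> 1/40" and b: "b < 2" and h: "\<forall>\<tau>\<in>set h. fst \<tau> < 2"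
  shows "regret (two_node \<delta> b) h =
    (\<Sum>t<length h. if fst (h ! t) = b then 0 else 2 * \<delta> / (3/400 - \<delta>\<^sup>2))"
proof -
  let ?m = "mean_reward (two_node \<delta> b)"
  have "\<delta>\<^sup>2 \<le> (1/40)\<^sup>2" using \<delta> by (intro power_mono) auto
  then have "0 \<le> 2 * \<delta> / (3/400 - \<delta>\<^sup>2)" using \<delta> by (simp add: power2_eq_square)
  then have le: "?m i \<le> ?m b" if "i < 2" for i
    using two_node_mean [OF \<delta> b that] by (cases "i = b") auto
  have "(MAX i\<in>{..<2}. \<Sum>t<length h. ?m i) = (\<Sum>t<length h. ?m b)"
    using b le by (intro Max_eqI) (auto intro!: mult_left_mono)
  then have "regret (two_node \<delta> b) h = (\<Sum>t<length h. ?m b - ?m (fst (h ! t)))"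
    by (simp add: regret_def sum_subtractf)
  also have "\<dots> = (\<Sum>t<length h. if fst (h ! t) = b then 0 else 2 * \<delta> / (3/400 - \<delta>\<^sup>2))"
    using h two_node_mean [OF \<delta> b] by (intro sum.cong) auto
  finally show ?thesis .
qed

section \<open>Affinity of a single two-node walk\<close>

text \<open>After squaring, the claim reduces to \<open>x^4 / a^2 \<le> x^2\<close>. It shows that a
  perturbation costs affinity only to second order.\<close>

lemma sqrt_diff_squares_ge:
  fixes a x :: real
  assumes "0 < a" "\<bar>x\<bar> \<le> a"
  shows "a - x\<^sup>2 / a \<le> sqrt ((a + x) * (a - x))"
proof (rule real_le_rsqrt)
  have "x\<^sup>2 \<le> a\<^sup>2" using assms by (metis abs_le_square_iff abs_of_pos)
  then have "(x\<^sup>2 / a)\<^sup>2 \<le> x\<^sup>2"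
    using assms mult_left_mono [of "x\<^sup>2" "a\<^sup>2" "x\<^sup>2"] by (simp add: power_divide field_simps power2_eq_square)
  then show "(a - x\<^sup>2 / a)\<^sup>2 \<le> (a + x) * (a - x)"
    using assms by (simp add: power2_diff) (simp add: algebra_simps power2_eq_square)
qed

lemma two_node_affinity:
  assumes \<delta>: "0 \<le> \<delta>" "\<delta> \<le> 1/40" and j: "j < 2"
  shows "ennreal (1 - 3800/9 * \<delta>\<^sup>2) \<le> affinity (walk (two_node \<delta> 0) (Some j)) (walk (two_node \<delta> 1) (Some j))"
proof -
  define B where "B j = affinity (walk (two_node \<delta> 0) (Some j)) (walk (two_node \<delta> 1) (Some j))" for j
  have r: "inf_norm_mat (transient_mat (two_node \<delta> b)) < 1" for b
    using two_node_inf_norm [OF \<delta>, of b] by simp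
  define s n where "s = sqrt ((9/10 + \<delta>) * (9/10 - \<delta>))" and "n = sqrt ((1/20 + \<delta>) * (1/20 - \<delta>))"
  have s: "9/10 - \<delta>\<^sup>2 / (9/10) \<le> s" and n: "1/20 - \<delta>\<^sup>2 / (1/20) \<le> n"
    unfolding s_def n_def using \<delta> sqrt_diff_squares_ge [of "9/10" \<delta>] sqrt_diff_squares_ge [of "1/20" \<delta>]
    by auto
  have sn: "0 \<le> s" "0 \<le> n" using \<delta> by (auto simp: s_def n_def)
  have N: "affinity (walk (two_node \<delta> 0) None) (walk (two_node \<delta> 1) None) = 1"
  proof -
    have "walk (two_node \<delta> 0) None = walk (two_node \<delta> 1) None"
      using two_node_valid [OF \<delta>] by (intro pmf_eqI) (simp add: pmf_walk r nodes_two_node)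
    then show ?thesis by simp
  qed
  have sqrt400: "sqrt (1/400) = 1/20"
    by (rule real_sqrt_unique) (simp_all add: power2_eq_square)
  \<comment> \<open>Exchanging the roles of the nodes only swaps the factors under the roots, so
    \<open>s\<close> and \<open>n\<close> are the same for both nodes.\<close>
  have step: "B j = ennreal n + ennreal s * B j + ennreal (1/20) * B (1 - j)" if "j < 2" for j
  proof -
    have l: "len (two_node \<delta> 1) = len (two_node \<delta> 0)" by (intro ext) simp
    have "B j = (\<Sum>v\<in>nodes (two_node \<delta> 0). ennreal (sqrt (prob (two_node \<delta> 0) j v * prob (two_node \<delta> 1) j v)) *
        affinity (walk (two_node \<delta> 0) v) (walk (two_node \<delta> 1) v))"
      unfolding B_def using \<delta> r that l by (intro affinity_walk_step two_node_valid) auto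
    also have "\<dots> = ennreal n + ennreal s * B j + ennreal (1/20) * B (1 - j)"
      using that
      by (auto simp: nodes_two_node less_2_nat N n_def s_def B_def sqrt400 mult.commute add_ac simp del: One_nat_def)
    finally show ?thesis .
  qed
  have "B j \<le> 1" for j by (simp add: B_def affinity_le_1)
  then have "B j < \<top>" for j
    by (meson ennreal_one_less_top le_less_trans)
  moreover define c where "c j = enn2real (B j)" for j
  ultimately have c: "\<And>j. B j = ennreal (c j)" "\<And>j. 0 \<le> c j"
    by simp_all
  have c1: "c j \<le> 1" for j
    using \<open>B j \<le> 1\<close> c [of j] by (simp flip: ennreal_1)
  have eq: "c j = n + s * c j + 1/20 * c (1 - j)" if "j < 2" for j
  proof -
    have "ennreal (c j) = ennreal (n + s * c j + 1/20 * c (1 - j))"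
      using step [OF that] c sn by (simp only: ennreal_plus ennreal_mult add_nonneg_nonneg mult_nonneg_nonneg)
    then show ?thesis using c sn by (subst (asm) ennreal_inj) auto
  qed
  \<comment> \<open>Bounding both equations below through the smaller affinity gives
    \<open>m \<ge> n + (s + 1/20) * m\<close>. With the bounds on \<open>s\<close> and
    \<open>n\<close>, and \<open>m \<le> 1\<close>, the loss is at most
    \<open>20 * (20 + 10/9) = 3800/9\<close> times \<open>\<delta>\<^sup>2\<close>.\<close>
  define m where "m = min (c 0) (c 1)"
  have m: "0 \<le> m" "m \<le> 1" "m \<le> c 0" "m \<le> c 1" using c c1 by (auto simp: m_def min_le_iff_disj)
  have ge: "n + s * m + 1/20 * m \<le> c j" if "j < 2" for j
    using m sn that by (subst eq [OF that], intro add_mono mult_left_mono) (auto simp: less_2_nat)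
  have "n + s * m + 1/20 * m \<le> m"
    using ge [of 0] ge [of 1] by (simp add: m_def)
  moreover have "(9/10 - \<delta>\<^sup>2 / (9/10)) * m \<le> s * m"
    using s m by (intro mult_right_mono)
  moreover have "\<delta>\<^sup>2 * m \<le> \<delta>\<^sup>2 * 1" using m by (intro mult_left_mono) auto
  ultimately have "1 - 3800/9 * \<delta>\<^sup>2 \<le> m"
    using n by (simp add: algebra_simps)
  then show ?thesis
    using m j unfolding B_def [symmetric] c by (intro ennreal_leI) (auto simp: less_2_nat)
qed

section \<open>Regret of an arbitrary policy\<close>

lemma two_node_expected_regret:
  assumes \<pi>: "valid_policy \<pi>" and T: "1 \<le> T" and \<delta>: "\<delta> = 1 / (40 * sqrt T)"
  shows "\<exists>b<2. sqrt T / 2 \<le> expected_regret (two_node \<delta> b) \<pi> T"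
proof -
  let ?P = "\<lambda>b. history_pmf (two_node \<delta> b) \<pi> T"
  define gap where "gap = 2 * \<delta> / (3/400 - \<delta>\<^sup>2)"
  have "1 \<le> sqrt T" using T by simp
  then have \<delta>01: "0 \<le> \<delta>" "\<delta> \<le> 1/40" by (auto simp: \<delta> field_simps)
  have d2: "\<delta>\<^sup>2 = 1 / (1600 * T)" using T by (simp add: \<delta> power_divide power_mult_distrib)
  have "\<delta>\<^sup>2 \<le> (1/40)\<^sup>2" using \<delta>01 by (intro power_mono) auto
  then have D: "0 < 3/400 - \<delta>\<^sup>2" by (simp add: power2_eq_square)
  have gap: "0 \<le> gap" "20/3 \<le> gap * sqrt T"
  proof -
    show "0 \<le> gap" using D \<delta>01 by (simp add: gap_def)
    have "20/3 = 2 * \<delta> / (3/400) * sqrt T" using T by (simp add: \<delta>)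
    also have "\<dots> \<le> gap * sqrt T"
      unfolding gap_def using D \<delta>01 by (intro mult_right_mono divide_left_mono) auto
    finally show "20/3 \<le> gap * sqrt T" .
  qed
  have supp: "length h = T" "\<forall>\<tau>\<in>set h. fst \<tau> < 2" if "h \<in> set_pmf (?P b)" for h b
    using set_history_pmf [OF \<pi> _ that] by auto
  \<comment> \<open>The history may come from either instance \<open>b'\<close>, so both regrets can
    be evaluated on the same history.\<close>
  have reg: "regret (two_node \<delta> b) h = (\<Sum>t<T. if fst (h ! t) = b then 0 else gap)"
    if "h \<in> set_pmf (?P b')" "b < 2" for b b' h
    using two_node_regret [OF \<delta>01 that(2) supp(2) [OF that(1)]] supp(1) [OF that(1)]
    unfolding gap_def by simp
  have nonneg: "0 \<le> regret (two_node \<delta> b) h" if "h \<in> set_pmf (?P b)" "b < 2" for b h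
    using gap by (auto simp: reg [OF that] intro!: sum_nonneg)
  have upper: "regret (two_node \<delta> b) h \<le> T * gap" if "h \<in> set_pmf (?P b)" "b < 2" for b h
    unfolding reg [OF that] using gap
      sum_bounded_above [of "{..<T}" "\<lambda>t. if fst (h ! t) = b then 0 else gap" gap] by auto
  have int: "integrable (?P b) (regret (two_node \<delta> b))" if "b < 2" for b
    using nonneg upper that
    by (intro measure_pmf.integrable_const_bound [where B = "T * gap"]) (auto simp: AE_measure_pmf_iff)
  \<comment> \<open>Each epoch plays the worse node of exactly one of the two instances and so costs
    \<open>gap\<close> in total.\<close>
  have total: "T * gap \<le> regret (two_node \<delta> 0) h + regret (two_node \<delta> 1) h"
    if "h \<in> set_pmf (?P 0)" for h
  proof -
    have fst: "fst (h ! t) = 0 \<or> fst (h ! t) = 1" if "t < T" for t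
      using supp [OF \<open>h \<in> set_pmf (?P 0)\<close>] that by (metis less_2_nat nth_mem)
    have "(\<Sum>t<T. gap) = (\<Sum>t<T. (if fst (h ! t) = 0 then 0 else gap) + (if fst (h ! t) = 1 then 0 else gap))"
    proof (intro sum.cong refl)
      fix t assume "t \<in> {..<T}"
      then show "gap = (if fst (h ! t) = 0 then 0 else gap) + (if fst (h ! t) = 1 then 0 else gap)"
        using fst [of t] by auto
    qed
    then show ?thesis using that by (simp add: reg sum.distrib)
  qed
  define \<beta> where "\<beta> = 1 - 3800/9 * \<delta>\<^sup>2"
  have \<beta>0: "0 \<le> \<beta>" using \<open>\<delta>\<^sup>2 \<le> (1/40)\<^sup>2\<close> by (simp add: \<beta>_def power2_eq_square)
  \<comment> \<open>By Bernoulli's inequality the loss over all epochs is at most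
    \<open>T * 3800/9 * \<delta>\<^sup>2 = 38/144\<close>.\<close>
  have \<beta>: "106/144 \<le> \<beta> ^ T"
  proof -
    have "106/144 = 1 + real T * (- (3800/9 * \<delta>\<^sup>2))" using T by (simp add: d2)
    also have "\<dots> \<le> (1 + - (3800/9 * \<delta>\<^sup>2)) ^ T"
      using \<beta>0 by (intro Bernoulli_inequality) (simp add: \<beta>_def)
    finally show ?thesis by (simp add: \<beta>_def)
  qed
  have "ennreal \<beta> ^ T \<le> affinity (?P 0) (?P 1)"
    using two_node_affinity [OF \<delta>01] \<pi> by (intro affinity_history) (auto simp: \<beta>_def)
  then have "ennreal (\<beta> ^ T) \<le> affinity (?P 0) (?P 1)"
    using \<beta>0 by (simp add: ennreal_power)
  then have two: "T * gap * (\<beta> ^ T)\<^sup>2 / 2 \<le>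
      expected_regret (two_node \<delta> 0) \<pi> T + expected_regret (two_node \<delta> 1) \<pi> T"
    unfolding expected_regret_def
    using \<beta>0 gap total int nonneg by (intro le_cam_two_point) auto
  have "sqrt T \<le> sqrt T * (20/3 * (106/144)\<^sup>2 / 2)"
    by (simp add: power2_eq_square)
  also have "\<dots> \<le> sqrt T * (gap * sqrt T * (\<beta> ^ T)\<^sup>2 / 2)"
    using gap \<beta> by (intro mult_left_mono divide_right_mono mult_mono power_mono) auto
  also have "\<dots> = T * gap * (\<beta> ^ T)\<^sup>2 / 2"
    by (simp add: mult_ac)
  finally have "sqrt T \<le> expected_regret (two_node \<delta> 0) \<pi> T + expected_regret (two_node \<delta> 1) \<pi> T"
    using two by linarith
  then have "sqrt T / 2 \<le> expected_regret (two_node \<delta> 0) \<pi> T \<or>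
      sqrt T / 2 \<le> expected_regret (two_node \<delta> 1) \<pi> T"
    by linarith
  then show ?thesis by (auto simp: less_2_nat)
qed

text \<open>In terms of \<open>x = \<epsilon> * sqrt T\<close> and with
  \<open>exp u \<ge> 1 + u\<close>, a quadratic inequality remains. Its square is centred at the
  minimiser 6/35, where the constant 32/175 is below 1/2.\<close>

lemma exp_rate_le_sqrt:
  fixes \<epsilon> :: real
  assumes "0 \<le> \<epsilon>"
  shows "32/15 * \<epsilon> * real T * exp (- (112/9) * real T * \<epsilon>\<^sup>2) \<le> sqrt T / 2"
proof -
  define x where "x = \<epsilon> * sqrt T"
  have x2: "x\<^sup>2 = real T * \<epsilon>\<^sup>2" by (simp add: x_def power_mult_distrib)
  have "32/15 * x \<le> (1 + 112/9 * x\<^sup>2) / 2"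
  proof -
    have "0 \<le> 56/9 * (x - 6/35)\<^sup>2" by simp
    also have "\<dots> = 56/9 * x\<^sup>2 - 32/15 * x + 32/175"
      by (simp add: power2_eq_square algebra_simps)
    finally show ?thesis by simp
  qed
  also have "\<dots> \<le> exp (112/9 * x\<^sup>2) / 2"
    by (intro divide_right_mono exp_ge_add_one_self) auto
  finally have "32/15 * x * exp (- (112/9 * x\<^sup>2)) \<le> 1 / 2"
    by (simp add: exp_minus field_simps)
  then have le: "sqrt T * (32/15 * x * exp (- (112/9 * x\<^sup>2))) \<le> sqrt T * (1 / 2)"
    by (intro mult_left_mono) auto
  have Tx: "sqrt T * x = \<epsilon> * T" by (simp add: x_def mult_ac)
  have "32/15 * \<epsilon> * real T * exp (- (112/9) * real T * \<epsilon>\<^sup>2) =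
      32/15 * (sqrt T * x) * exp (- (112/9 * x\<^sup>2))"
    unfolding Tx x2 by (simp add: mult_ac)
  then show ?thesis using le by (simp add: mult_ac)
qed

theorem theorem1:
  "\<exists>(\<rho>::real) (c::real) (r1 :: real \<Rightarrow> real) (r2 :: real \<Rightarrow> real) (d::real) (T0::nat).
     0 < \<rho> \<and> \<rho> < 1 \<and> 0 < c \<and>
     r1 \<in> O[principal {0<..<1/4}](\<lambda>\<epsilon>. \<epsilon> ^ 2) \<and>
     r2 \<in> O[principal {0<..<1/4}](\<lambda>\<epsilon>. \<epsilon> ^ 3) \<and>
     0 < d \<and>
     (\<forall>(T::nat) (\<pi>::policy). valid_policy \<pi> \<longrightarrow>
       (\<exists>I. valid_bandit I \<and>
            primitive_mat (transient_mat I) \<and>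
            inf_norm_mat (transient_mat I) \<le> \<rho> \<and>
            (\<forall>i<num_nodes I. \<forall>j<num_nodes I. i \<noteq> j \<longrightarrow> visit_prob I i j > c) \<and>
            (\<forall>\<epsilon>::real. 0 < \<epsilon> \<and> \<epsilon> < 1/4 \<longrightarrow>
               expected_regret I \<pi> T \<ge>
                 (32/15 * \<epsilon> + r1 \<epsilon>) * real T *
                   exp (- (112/9) * real T * (\<epsilon> ^ 2 + r2 \<epsilon>))) \<and>
            (T \<ge> T0 \<longrightarrow> expected_regret I \<pi> T \<ge> d * sqrt (real T))))"
\<comment> \<open>39/40 is the largest possible row sum, \<open>19/20 + \<delta>\<close> at
  \<open>\<delta> = 1/40\<close>, and 1/40 lies strictly below the crossing probability 1/20. The
  bound \<open>sqrt T / 2\<close> holds for all \<open>T\<close>, so the threshold is 0.\<close>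
proof (rule exI [of _ "39/40"], rule exI [of _ "1/40"], rule exI [of _ "\<lambda>_. 0"],
    rule exI [of _ "\<lambda>_. 0"], rule exI [of _ "1/2"], rule exI [of _ 0], intro conjI allI impI)
  fix T :: nat and \<pi> :: policy
  assume \<pi>: "valid_policy \<pi>"
  \<comment> \<open>Neither \<open>\<delta>\<close> nor the later choice of \<open>b\<close> depends
    on \<open>\<epsilon>\<close>, so one instance serves every \<open>\<epsilon>\<close>. For
    \<open>T = 0\<close> the regret and the bound are both 0.\<close>
  define \<delta> where "\<delta> = (if T = 0 then 0 else 1 / (40 * sqrt T))"
  have \<delta>: "0 \<le> \<delta>" "\<delta> \<le> 1/40"
    by (auto simp: \<delta>_def field_simps)
  have "\<exists>b<2. sqrt T / 2 \<le> expected_regret (two_node \<delta> b) \<pi> T"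
  proof (cases "T = 0")
    case True
    then have "expected_regret (two_node \<delta> 0) \<pi> T = 0"
      by (simp add: expected_regret_def regret_def lessThan_2_nat)
    then show ?thesis using True by (intro exI [of _ 0]) auto
  next
    case False
    then show ?thesis using \<pi> by (intro two_node_expected_regret) (auto simp: \<delta>_def)
  qed
  then obtain b where b: "sqrt T / 2 \<le> expected_regret (two_node \<delta> b) \<pi> T" by blast
  let ?I = "two_node \<delta> b"
  have valid: "valid_bandit ?I" and prim: "primitive_mat (transient_mat ?I)"
    and norm: "inf_norm_mat (transient_mat ?I) \<le> 39/40"
    using two_node_valid [OF \<delta>] two_node_primitive [OF \<delta>] two_node_inf_norm [OF \<delta>] by blast+
  have visit: "1/40 < visit_prob ?I i j"
    if "i < num_nodes ?I" "j < num_nodes ?I" "i \<noteq> j" for i j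
    using visit_prob_ge_prob [OF valid _ that(1,2)] norm that(3) by simp
  have rate: "(32/15 * \<epsilon> + 0) * real T * exp (- (112/9) * real T * (\<epsilon> ^ 2 + 0)) \<le> expected_regret ?I \<pi> T"
    if "0 < \<epsilon>" for \<epsilon>
    using exp_rate_le_sqrt [of \<epsilon> T] b that by simp
  show "\<exists>I. valid_bandit I \<and>
            primitive_mat (transient_mat I) \<and>
            inf_norm_mat (transient_mat I) \<le> 39/40 \<and>
            (\<forall>i<num_nodes I. \<forall>j<num_nodes I. i \<noteq> j \<longrightarrow> visit_prob I i j > 1/40) \<and>
            (\<forall>\<epsilon>::real. 0 < \<epsilon> \<and> \<epsilon> < 1/4 \<longrightarrow>
               expected_regret I \<pi> T \<ge>
                 (32/15 * \<epsilon> + 0) * real T *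
                   exp (- (112/9) * real T * (\<epsilon> ^ 2 + 0))) \<and>
            (T \<ge> 0 \<longrightarrow> expected_regret I \<pi> T \<ge> 1/2 * sqrt (real T))"
    using valid prim norm visit rate b by (intro exI [of _ ?I]) simp
qed simp_all

end
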